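(* If $G$ is an $(n/4,t)$-Ruzsa–Szemerédi graph on $n$ vertices, then $t \le 8(\log_2 n + 1)$.
   Context: All graphs are finite and simple. A matching $M$ in a graph $G$ is an induced matching if the subgraph of $G$ induced on the set of vertices covered by $M$ has edge set exactly $M$. A graph $G$ is an $(r,t)$-Ruzsa–Szemerédi graph if its edge set can be partitioned into $t$ pairwise edge-disjoint induced matchings, each consisting of exactly $r$ edges. *)

theory Defs
  imports Complex_Main "HOL-Library.Disjoint_Sets"
begin

text \<open>An undirected edge is the two-element set of its end points.\<close>

definition simple_graph :: "'a set \<Rightarrow> 'a set set \<Rightarrow> bool" where
  "simple_graph V E \<longleftrightarrow> finite V \<and> (\<forall>e\<in>E. e \<subseteq> V \<and> card e = 2)"

definition matching :: "'a set set \<Rightarrow> 'a set set \<Rightarrow> bool" where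
  "matching E M \<longleftrightarrow> M \<subseteq> E \<and> disjoint M"

definition induced_edges :: "'a set set \<Rightarrow> 'a set \<Rightarrow> 'a set set" where
  "induced_edges E U = {e \<in> E. e \<subseteq> U}"

definition induced_matching :: "'a set set \<Rightarrow> 'a set set \<Rightarrow> bool" where
  "induced_matching E M \<longleftrightarrow> matching E M \<and> induced_edges E (\<Union>M) = M"

definition ruzsa_szemeredi :: "'a set \<Rightarrow> 'a set set \<Rightarrow> nat \<Rightarrow> nat \<Rightarrow> bool" where
  "ruzsa_szemeredi V E r t \<longleftrightarrow>
     simple_graph V E \<and>
     (\<exists>P. partition_on E P \<and> card P = t \<and> (\<forall>M\<in>P. induced_matching E M \<and> card M = r))"

end

theory Submission
  imports Defs
begin

text \<open>
  Give every vertex \<open>u\<close> the set \<open>S u\<close> of matchings covering it. If \<open>uv\<close> is an edge of the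
  matching \<open>M\<close>, then \<open>S u \<inter> S v = {M}\<close> because the matchings are induced. Summing
  \<open>card (S u) + card (S v)\<close> over all edges and using the Cauchy--Schwarz inequality, on average
  over the edges at most one matching misses both end points, so at least half of the edges are
  missed by at most one matching. For such an edge, \<open>S u\<close> and the complement of \<open>S v\<close> differ in
  \<open>M\<close> and in at most one further matching. Fix a linear order of the matchings; in it or in its
  reverse, \<open>M\<close> is the first difference for at least a quarter of all edges. As in the
  edge-isoperimetric inequality of the hypercube, splitting \<open>2 n\<close> points (two copies of the
  vertices, labelled by \<open>S\<close> and by its complement) along one matching after the other shows that
  there are at most \<open>n log (2 n) / 2\<close> such edges.
\<close>

section \<open>An isoperimetric bound for first differences\<close>

text \<open>This drives the induction below: splitting a point set into parts of sizes
  \<open>a\<close> and \<open>b\<close> separates at most \<open>min a b\<close> pairs, which the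
  growth of \<open>x * log 2 x / 2\<close> pays for.\<close>

lemma half_mult_log_superadditive:
  fixes a b :: nat
  shows "real a * log 2 a / 2 + real b * log 2 b / 2 + real (min a b)
    \<le> real (a + b) * log 2 (a + b) / 2"
proof (induction a b rule: linorder_wlog)
  case (le a b)
  show ?case
  proof (cases "a = 0")
    case True
    then show ?thesis by simp
  next
    case False
    \<comment> \<open>With \<open>a\<close> fixed as the smaller part, the claim becomes
      \<open>h a \<le> h b\<close>; the value \<open>h a\<close> supplies the term
      \<open>2 * a * ln 2\<close>, which turns into \<open>min a b\<close> after division by
      \<open>2 * ln 2\<close>.\<close>
    define h where "h x = (a + x) * ln (a + x) - x * ln x" for x :: real
    have "h a \<le> h b"
    proof (rule DERIV_nonneg_imp_nondecreasing[where f = h])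
      fix x :: real assume "real a \<le> x" "x \<le> real b"
      then have "x > 0" using False by simp
      have "(h has_real_derivative ln (a + x) - ln x) (at x)"
        unfolding h_def using \<open>x > 0\<close> by (auto intro!: derivative_eq_intros)
      moreover have "ln (a + x) - ln x \<ge> 0" using \<open>x > 0\<close> by simp
      ultimately show "\<exists>y. (h has_real_derivative y) (at x) \<and> y \<ge> 0" by blast
    qed (use le in simp)
    moreover have "h a = 2 * a * ln 2 + a * ln a"
      using False ln_mult[of 2 "real a"] by (simp add: h_def algebra_simps)
    ultimately have "a * ln a + b * ln b + 2 * a * ln 2 \<le> (a + b) * ln (a + b)"
      by (simp add: h_def)
    then have "(a * ln a + b * ln b + 2 * a * ln 2) / (2 * ln 2)
        \<le> (a + b) * ln (a + b) / (2 * ln 2)"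
      by (intro divide_right_mono) auto
    then show ?thesis using le by (simp add: log_def add_divide_distrib)
  qed
next
  case (sym a b)
  then show ?case by (simp add: add.commute min.commute)
qed

lemma card_le_if_matching_relation:
  assumes "R \<subseteq> A \<times> B" "finite A" "finite B" "inj_on fst R" "inj_on snd R"
  shows "card R \<le> card A" "card R \<le> card B"
  using assms by (auto intro!: card_inj_on_le)

text \<open>
  Points of \<open>A\<close> and \<open>B\<close> are labelled by sets of coordinates; every pair in \<open>R i\<close> has \<open>i\<close> as its
  first difference, where larger \<open>rank\<close> means earlier.
\<close>

lemma sum_card_first_difference_le:
  fixes rank :: "'i \<Rightarrow> 'l :: linorder" and f :: "'a \<Rightarrow> 'i set" and g :: "'b \<Rightarrow> 'i set"
  assumes "finite I" "inj_on rank I" "finite A" "finite B"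
    and "\<And>i. i \<in> I \<Longrightarrow> R i \<subseteq> A \<times> B"
    and "\<And>i. i \<in> I \<Longrightarrow> inj_on fst (R i) \<and> inj_on snd (R i)"
    and "\<And>i x y. i \<in> I \<Longrightarrow> (x, y) \<in> R i \<Longrightarrow> i \<in> f x \<and> i \<notin> g y"
    and "\<And>i j x y. i \<in> I \<Longrightarrow> (x, y) \<in> R i \<Longrightarrow> j \<in> I \<Longrightarrow> rank i < rank j \<Longrightarrow> j \<in> f x \<longleftrightarrow> j \<in> g y"
  shows "real (\<Sum>i\<in>I. card (R i)) \<le> real (card A + card B) * log 2 (card A + card B) / 2"
  using assms
proof (induction I arbitrary: A B R rule: finite_ranking_induct[where f = rank])
  case empty
  have "0 \<le> real k * log 2 k" for k :: nat by (cases "k = 0") auto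
  from this[of "card A + card B"] show ?case by simp
next
  case (insert c I)
  show ?case
  \<comment> \<open>The new \<open>c\<close> has maximal rank, so it is the earliest coordinate; the
    induction rule does not exclude that it is already in \<open>I\<close>.\<close>
  proof (cases "c \<in> I")
    case True
    then show ?thesis using insert.IH[of A B R] insert.prems by (simp add: insert_absorb)
  next
    case False
    have less: "rank i < rank c" if "i \<in> I" for i
      using insert.hyps(2)[OF that] insert.prems(1) that False
      by (metis inj_on_eq_iff insertCI order_le_less)
    define A1 A0 where "A1 = {x \<in> A. c \<in> f x}" and "A0 = {x \<in> A. c \<notin> f x}"
    define B1 B0 where "B1 = {y \<in> B. c \<in> g y}" and "B0 = {y \<in> B. c \<notin> g y}"
    define R1 R0 where "R1 i = R i \<inter> A1 \<times> B1" and "R0 i = R i \<inter> A0 \<times> B0" for i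
    have fin: "finite A1" "finite A0" "finite B1" "finite B0"
      using insert.prems by (auto simp: A1_def A0_def B1_def B0_def)
    have "card A = card A1 + card A0"
      using fin by (subst card_Un_disjoint[symmetric]) (auto simp: A1_def A0_def intro!: arg_cong[of _ _ card])
    moreover have "card B = card B1 + card B0"
      using fin by (subst card_Un_disjoint[symmetric]) (auto simp: B1_def B0_def intro!: arg_cong[of _ _ card])
    ultimately have split: "card A + card B = (card A1 + card B1) + (card A0 + card B0)" by simp
    \<comment> \<open>Pairs of \<open>R c\<close> cross between the two halves, and each point lies
      in at most one of them. All other pairs agree on the earlier coordinate \<open>c\<close> and
      stay inside one half.\<close>
    have Rc: "R c \<subseteq> A1 \<times> B0"
      using insert.prems(4)[of c] insert.prems(6)[of c] by (auto simp: A1_def B0_def)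
    have "card (R c) \<le> card A1" "card (R c) \<le> card B0"
      using card_le_if_matching_relation[OF Rc] fin insert.prems(5)[of c] by auto
    then have c: "card (R c) \<le> min (card A1 + card B1) (card A0 + card B0)" by simp
    have "card (R i) = card (R1 i) + card (R0 i)" if "i \<in> I" for i
    proof -
      have "R i = R1 i \<union> R0 i"
      proof (intro equalityI subrelI)
        fix x y assume xy: "(x, y) \<in> R i"
        then have "x \<in> A" "y \<in> B" using insert.prems(4)[of i] that by auto
        moreover have "c \<in> f x \<longleftrightarrow> c \<in> g y"
          using insert.prems(7)[OF _ xy, of c] less[OF that] that by simp
        ultimately show "(x, y) \<in> R1 i \<union> R0 i"
          using xy by (simp add: R1_def R0_def A1_def A0_def B1_def B0_def)
      qed (auto simp: R1_def R0_def)
      moreover have "R1 i \<inter> R0 i = {}" by (auto simp: R1_def R0_def A1_def A0_def)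
      moreover have "finite (R1 i)" "finite (R0 i)" using fin by (auto simp: R1_def R0_def)
      ultimately show ?thesis by (simp add: card_Un_disjoint)
    qed
    then have "(\<Sum>i\<in>I. card (R i)) = (\<Sum>i\<in>I. card (R1 i)) + (\<Sum>i\<in>I. card (R0 i))"
      by (simp add: sum.distrib)
    moreover have part: "real (\<Sum>i\<in>I. card (R i \<inter> A' \<times> B'))
        \<le> real (card A' + card B') * log 2 (card A' + card B') / 2"
      if "finite A'" "finite B'" for A' B'
    proof (rule insert.IH)
      show "inj_on rank I" using insert.prems(1) by simp
      show "inj_on fst (R i \<inter> A' \<times> B') \<and> inj_on snd (R i \<inter> A' \<times> B')" if "i \<in> I" for i
        using insert.prems(5)[of i] that by (auto intro: inj_on_subset)
      show "i \<in> f x \<and> i \<notin> g y" if "i \<in> I" "(x, y) \<in> R i \<inter> A' \<times> B'" for i x y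
        using insert.prems(6)[of i x y] that by simp
      show "j \<in> f x \<longleftrightarrow> j \<in> g y"
        if "i \<in> I" "(x, y) \<in> R i \<inter> A' \<times> B'" "j \<in> I" "rank i < rank j" for i j x y
        using insert.prems(7)[of i x y j] that by simp
    qed (use that in auto)
    moreover note part[OF fin(1,3), folded R1_def] part[OF fin(2,4), folded R0_def]
    moreover note half_mult_log_superadditive[of "card A1 + card B1" "card A0 + card B0"]
    moreover have "(\<Sum>i\<in>insert c I. card (R i)) = card (R c) + (\<Sum>i\<in>I. card (R i))"
      using insert.hyps False by simp
    ultimately show ?thesis
      unfolding split using c by linarith
  qed
qed

lemma card_ordered_pairs:
  assumes "finite F" "\<And>e. e \<in> F \<Longrightarrow> card e = 2"
  shows "card {(u, v). {u, v} \<in> F} = 2 * card F"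
proof -
  have two: "card {(u, v). {u, v} = e} = 2 \<and> finite {(u, v). {u, v} = e}" if e: "e \<in> F" for e
  proof -
    obtain a b where "e = {a, b}" "a \<noteq> b" using assms(2)[OF e] by (meson card_2_iff)
    moreover from this have "{(u, v). {u, v} = e} = {(a, b), (b, a)}" by (auto simp: doubleton_eq_iff)
    ultimately show ?thesis by simp
  qed
  have "{(u, v). {u, v} \<in> F} = (\<Union>e\<in>F. {(u, v). {u, v} = e})" by auto
  also have "card \<dots> = (\<Sum>e\<in>F. card {(u, v). {u, v} = e})"
    using assms(1) two by (intro card_UN_disjoint) auto
  also have "\<dots> = 2 * card F" using two by simp
  finally show ?thesis .
qed

section \<open>Vertices labelled by the matchings that cover them\<close>

locale induced_matching_partition =
  fixes V :: "'a set" and E :: "'a set set" and P :: "'a set set set"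
  assumes simple: "simple_graph V E"
    and part: "partition_on E P"
    and induced: "\<And>M. M \<in> P \<Longrightarrow> induced_matching E M"
begin

definition covering :: "'a \<Rightarrow> 'a set set set" where
  "covering u = {M \<in> P. u \<in> \<Union>M}"

definition missing :: "'a set \<Rightarrow> 'a set set set" where
  "missing e = {M \<in> P. e \<inter> \<Union>M = {}}"

lemma finite_V: "finite V"
  using simple by (simp add: simple_graph_def)

lemma edge: "e \<in> E \<Longrightarrow> e \<subseteq> V \<and> card e = 2"
  using simple by (simp add: simple_graph_def)

lemma finite_E: "finite E"
  using finite_V edge by (auto intro: finite_subset[of E "Pow V"])

lemma finite_P: "finite P"
  using part finite_E finite_elements by blast

lemma E_eq: "E = \<Union>P"
  using part by (simp add: partition_on_def)

lemma sum_card_P: "(\<Sum>M\<in>P. card M) = card E"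
proof (rule product_partition[OF part, symmetric])
  show "finite M" if "M \<in> P" for M
    using that finite_E E_eq by (auto intro: finite_subset[of M E])
qed

lemma matching_unique: "e \<in> M \<Longrightarrow> e \<in> N \<Longrightarrow> M \<in> P \<Longrightarrow> N \<in> P \<Longrightarrow> M = N"
  using part by (auto simp: partition_on_def disjoint_def)

lemma edge_unique: "M \<in> P \<Longrightarrow> e \<in> M \<Longrightarrow> e' \<in> M \<Longrightarrow> u \<in> e \<Longrightarrow> u \<in> e' \<Longrightarrow> e = e'"
  using induced[of M] by (auto simp: induced_matching_def matching_def disjoint_def)

text \<open>A matching covering both end points must contain the edge, because it is induced, and
  only \<open>M\<close> contains it.\<close>

lemma covering_inter:
  assumes "M \<in> P" "{u, v} \<in> M"
  shows "covering u \<inter> covering v = {M}"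
proof -
  have "N = M" if "N \<in> covering u" "N \<in> covering v" for N
  proof -
    have "{u, v} \<in> induced_edges E (\<Union>N)"
      using assms that E_eq by (auto simp: induced_edges_def covering_def)
    then have "{u, v} \<in> N" using induced[of N] that
      by (auto simp: induced_matching_def covering_def)
    then show ?thesis using matching_unique assms that by (auto simp: covering_def)
  qed
  then show ?thesis using assms by (auto simp: covering_def)
qed

text \<open>Each matching covering \<open>u\<close> has exactly one edge at \<open>u\<close>, and
  each edge lies in exactly one matching, so the label size is the degree.\<close>

lemma card_covering: "card (covering u) = card {e \<in> E. u \<in> e}"
proof -
  have "bij_betw (\<lambda>M. THE e. e \<in> M \<and> u \<in> e) (covering u) {e \<in> E. u \<in> e}"
  proof (rule bij_betwI')
    have the: "(THE e. e \<in> M \<and> u \<in> e) \<in> M \<and> u \<in> (THE e. e \<in> M \<and> u \<in> e)"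
      if "M \<in> covering u" for M
    proof (rule theI')
      show "\<exists>!e. e \<in> M \<and> u \<in> e"
        using that edge_unique[of M] by (auto simp: covering_def)
    qed
    show "(THE e. e \<in> M \<and> u \<in> e) = (THE e. e \<in> N \<and> u \<in> e) \<longleftrightarrow> M = N"
      if "M \<in> covering u" "N \<in> covering u" for M N
    proof -
      have "M \<in> P" "N \<in> P" using that by (auto simp: covering_def)
      with the[OF that(1)] the[OF that(2)] show ?thesis
        using matching_unique[of "THE e. e \<in> M \<and> u \<in> e" M N] by auto
    qed
    show "(THE e. e \<in> M \<and> u \<in> e) \<in> {e \<in> E. u \<in> e}" if "M \<in> covering u" for M
      using the[OF that] that E_eq by (auto simp: covering_def)
    show "\<exists>M\<in>covering u. e = (THE e. e \<in> M \<and> u \<in> e)" if e: "e \<in> {e \<in> E. u \<in> e}" for e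
    proof -
      obtain M where M: "M \<in> P" "e \<in> M" using e E_eq by blast
      then have "M \<in> covering u" using e by (auto simp: covering_def)
      then show ?thesis using the[of M] edge_unique[of M e _ u] M e by blast
    qed
  qed
  then show ?thesis by (rule bij_betw_same_card)
qed

text \<open>Double counting of incidences. Weight 1 gives the handshake identity, the degree as
  weight gives the sum of squared degrees.\<close>

lemma sum_over_edges:
  fixes w :: "'a \<Rightarrow> nat"
  shows "(\<Sum>e\<in>E. \<Sum>u\<in>e. w u) = (\<Sum>u\<in>V. card (covering u) * w u)"
proof -
  have "(\<Sum>e\<in>E. \<Sum>u\<in>e. w u) = (\<Sum>e\<in>E. \<Sum>u | u \<in> V \<and> u \<in> e. w u)"
    using edge by (intro sum.cong refl) auto
  also have "\<dots> = (\<Sum>u\<in>V. \<Sum>e | e \<in> E \<and> u \<in> e. w u)"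
    by (rule sum.swap_restrict[OF finite_E finite_V])
  finally show ?thesis by (simp add: card_covering)
qed

text \<open>Inclusion-exclusion: the matching containing \<open>e\<close> is the only one counted at
  both end points, hence the 1.\<close>

lemma card_missing:
  assumes "e \<in> E"
  shows "card (missing e) + (\<Sum>u\<in>e. card (covering u)) = card P + 1"
proof -
  obtain u v where e: "e = {u, v}" "u \<noteq> v" using edge[OF assms] by (meson card_2_iff)
  obtain M where M: "M \<in> P" "e \<in> M" using assms E_eq by blast
  have fin: "finite (covering x)" for x using finite_P by (simp add: covering_def)
  have "card (covering u) + card (covering v) = card (covering u \<union> covering v) + 1"
    using card_Un_Int[OF fin fin, of u v] covering_inter[OF M(1)] M(2) e by simp
  moreover have "P = missing e \<union> (covering u \<union> covering v)"
    using e by (auto simp: missing_def covering_def)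
  moreover have "card (missing e \<union> (covering u \<union> covering v))
      = card (missing e) + card (covering u \<union> covering v)"
    using fin finite_P e by (intro card_Un_disjoint) (auto simp: missing_def covering_def)
  ultimately show ?thesis using e by simp
qed

section \<open>Averaging the number of missed matchings\<close>

text \<open>The hypothesis is \<open>n = 4 * r\<close> multiplied by \<open>t\<close>, since
  \<open>card E = t * r\<close>; it makes the average degree \<open>t / 2\<close>.\<close>

lemma sum_card_missing_le:
  assumes "card P * card V = 4 * card E"
  shows "(\<Sum>e\<in>E. card (missing e)) \<le> card E"
proof -
  let ?t = "real (card P)" and ?d = "\<lambda>u. real (card (covering u))"
  have "(\<Sum>u\<in>V. card (covering u)) = 2 * card E"
    using sum_over_edges[of "\<lambda>_. 1"] edge by simp
  then have handshake: "(\<Sum>u\<in>V. ?d u) = 2 * card E"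
    by (metis of_nat_mult of_nat_numeral of_nat_sum)
  have "(\<Sum>e\<in>E. card (missing e)) + (\<Sum>u\<in>V. card (covering u) * card (covering u))
      = (\<Sum>e\<in>E. card (missing e) + (\<Sum>u\<in>e. card (covering u)))"
    by (simp add: sum.distrib sum_over_edges)
  also have "\<dots> = card E * (card P + 1)" using card_missing by simp
  finally have "real ((\<Sum>e\<in>E. card (missing e)) + (\<Sum>u\<in>V. card (covering u) * card (covering u)))
      = real (card E * (card P + 1))" by (rule arg_cong)
  then have total: "(\<Sum>e\<in>E. real (card (missing e))) + (\<Sum>u\<in>V. ?d u * ?d u) = card E * (?t + 1)"
    by (simp add: algebra_simps)
  \<comment> \<open>Cauchy-Schwarz in variance form: the squared degrees sum to at least
    \<open>?t * card E\<close>, which leaves at most \<open>card E\<close> in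
    \<open>total\<close>.\<close>
  have "0 \<le> (\<Sum>u\<in>V. (?d u - ?t / 2)\<^sup>2)" by (simp add: sum_nonneg)
  also have "\<dots> = (\<Sum>u\<in>V. ?d u * ?d u - ?t * ?d u + ?t\<^sup>2 / 4)"
    by (intro sum.cong refl) (simp add: power2_eq_square field_simps)
  also have "\<dots> = (\<Sum>u\<in>V. ?d u * ?d u) - ?t * (2 * card E) + card V * ?t\<^sup>2 / 4"
    by (simp add: sum.distrib sum_subtractf sum_distrib_left[symmetric] handshake)
  also have "card V * ?t\<^sup>2 / 4 = ?t * card E"
    using arg_cong[OF assms, of real] by (simp add: power2_eq_square algebra_simps)
  finally have "(\<Sum>e\<in>E. real (card (missing e))) \<le> card E"
    using total by (simp add: algebra_simps)
  then show ?thesis by (simp only: of_nat_sum[symmetric] of_nat_le_iff)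
qed

text \<open>Markov's inequality: every other edge contributes at least 2 to a sum of at most
  \<open>card E\<close>.\<close>

lemma card_few_missing_ge:
  assumes "card P * card V = 4 * card E"
  shows "card E \<le> 2 * card {e \<in> E. card (missing e) \<le> 1}"
proof -
  let ?B = "{e \<in> E. \<not> card (missing e) \<le> 1}"
  have "2 * card ?B = (\<Sum>e\<in>?B. 2)" by simp
  also have "\<dots> \<le> (\<Sum>e\<in>?B. card (missing e))" by (intro sum_mono) auto
  also have "\<dots> \<le> (\<Sum>e\<in>E. card (missing e))" using finite_E by (intro sum_mono2) auto
  also have "\<dots> \<le> card E" by (rule sum_card_missing_le[OF assms])
  finally have "2 * card ?B \<le> card E" .
  moreover have "E = {e \<in> E. card (missing e) \<le> 1} \<union> ?B" by blast
  then have "card E = card {e \<in> E. card (missing e) \<le> 1} + card ?B"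
    using finite_E by (metis (no_types, lifting) card_Un_disjoint disjoint_iff finite_Un mem_Collect_eq)
  ultimately show ?thesis by linarith
qed

section \<open>Edges whose own matching is the first difference\<close>

text \<open>For an edge \<open>{u, v}\<close> of \<open>M\<close>, the sets
  \<open>covering u\<close> and \<open>- covering v\<close> differ exactly in \<open>M\<close> and
  in \<open>missing {u, v}\<close>. Ranks are integers so that negation reverses the order.\<close>

definition leading :: "('a set set \<Rightarrow> int) \<Rightarrow> 'a set set" where
  "leading rank = {e \<in> E. \<forall>M\<in>P. e \<in> M \<longrightarrow> (\<forall>N\<in>missing e. rank N < rank M)}"

lemma card_leading_le:
  assumes "inj_on rank P"
  shows "2 * real (card (leading rank)) \<le> card V * log 2 (2 * card V)"
proof -
  let ?F = "leading rank"
  \<comment> \<open>The two copies of \<open>V\<close> carry different labels, so each edge occurs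
    in both orientations and is counted twice.\<close>
  define R where "R M = {(u, v). {u, v} \<in> M \<and> {u, v} \<in> ?F}" for M
  have RV: "R M \<subseteq> V \<times> V" for M using edge by (auto simp: R_def leading_def)
  have "(\<Union>M\<in>P. R M) = {(u, v). {u, v} \<in> ?F}"
  proof -
    have "?F \<subseteq> E" by (auto simp: leading_def)
    then have "?F \<subseteq> \<Union>P" by (simp only: E_eq[symmetric])
    then show ?thesis by (auto simp: R_def)
  qed
  moreover have "card (\<Union>M\<in>P. R M) = (\<Sum>M\<in>P. card (R M))"
  proof (intro card_UN_disjoint ballI impI finite_P)
    show "finite (R M)" for M using RV finite_V by (meson finite_SigmaI finite_subset)
    show "R M \<inter> R N = {}" if "M \<in> P" "N \<in> P" "M \<noteq> N" for M N
      using matching_unique[of _ M N] that by (auto simp: R_def)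
  qed
  moreover have "card {(u, v). {u, v} \<in> ?F} = 2 * card ?F"
    using finite_E edge by (intro card_ordered_pairs) (auto simp: leading_def)
  ultimately have "(\<Sum>M\<in>P. card (R M)) = 2 * card ?F" by simp
  moreover have "real (\<Sum>M\<in>P. card (R M)) \<le> real (card V + card V) * log 2 (card V + card V) / 2"
  proof (rule sum_card_first_difference_le[where rank = rank and f = covering and g = "\<lambda>v. - covering v"])
    show "inj_on fst (R M) \<and> inj_on snd (R M)" if M: "M \<in> P" for M
    proof -
      have "u = u' \<longleftrightarrow> v = v'" if "(u, v) \<in> R M" "(u', v') \<in> R M" for u v u' v'
        using edge_unique[OF M, of "{u, v}" "{u', v'}" u] edge_unique[OF M, of "{u, v}" "{u', v'}" v] that
        by (auto simp: R_def doubleton_eq_iff)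
      then show ?thesis by (auto simp: inj_on_def)
    qed
    show "M \<in> covering u \<and> M \<notin> - covering v" if "M \<in> P" "(u, v) \<in> R M" for M u v
      using covering_inter[of M u v] that by (auto simp: R_def)
    show "N \<in> covering u \<longleftrightarrow> N \<in> - covering v"
      if "M \<in> P" "(u, v) \<in> R M" "N \<in> P" "rank M < rank N" for M N u v
    proof -
      have "{u, v} \<in> M" "\<forall>K\<in>P. {u, v} \<in> K \<longrightarrow> (\<forall>N\<in>missing {u, v}. rank N < rank K)"
        using that(2) by (simp_all add: R_def leading_def)
      \<comment> \<open>A matching ranked above \<open>M\<close> is not missed, so it covers an end
        point; it cannot cover both, as only \<open>M\<close> does.\<close>
      then have "N \<notin> missing {u, v}" using that(1,4) by (meson order_less_asym)
      then have "N \<in> covering u \<or> N \<in> covering v" using that by (auto simp: missing_def covering_def)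
      moreover have "N \<notin> covering u \<inter> covering v"
        using covering_inter[of M u v] that by (auto simp: R_def)
      ultimately show ?thesis by blast
    qed
  qed (use assms finite_P finite_V RV in auto)
  ultimately show ?thesis by (simp del: of_nat_sum)
qed

text \<open>A single missed matching ranks either below or above that of \<open>e\<close>; in the
  second case reversing the order makes \<open>e\<close> leading.\<close>

lemma few_missing_subset_leading:
  assumes "inj_on rank P"
  shows "{e \<in> E. card (missing e) \<le> 1} \<subseteq> leading rank \<union> leading (\<lambda>M. - rank M)"
proof
  fix e assume e: "e \<in> {e \<in> E. card (missing e) \<le> 1}"
  then obtain M where M: "M \<in> P" "e \<in> M" using E_eq by blast
  have uniq: "N = M" if "N \<in> P" "e \<in> N" for N using matching_unique M that by blast
  have fin: "finite (missing e)" using finite_P by (simp add: missing_def)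
  have "e \<noteq> {}" using e edge by fastforce
  then have "M \<notin> missing e" using M by (auto simp: missing_def)
  then have ne: "rank N \<noteq> rank M" if "N \<in> missing e" for N
    using assms that M by (auto simp: inj_on_def missing_def)
  have "N = N'" if "N \<in> missing e" "N' \<in> missing e" for N N'
    using e fin that card_le_Suc0_iff_eq by auto
  then have "(\<forall>N\<in>missing e. rank N < rank M) \<or> (\<forall>N\<in>missing e. rank M < rank N)"
    using ne by (metis linorder_neqE)
  then show "e \<in> leading rank \<union> leading (\<lambda>M. - rank M)"
    using e uniq by (auto simp: leading_def)
qed

lemma card_edges_le:
  assumes "card P * card V = 4 * card E"
  shows "real (card E) \<le> 2 * real (card V) * log 2 (2 * card V)"
proof -
  obtain h :: "'a set set \<Rightarrow> nat" where "inj_on h P"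
    using finite_imp_inj_to_nat_seg[OF finite_P] by blast
  then have inj: "inj_on (\<lambda>M. int (h M)) P" "inj_on (\<lambda>M. - int (h M)) P"
    by (auto simp: inj_on_def)
  let ?L = "leading (\<lambda>M. int (h M))" and ?L' = "leading (\<lambda>M. - int (h M))"
  have "finite (?L \<union> ?L')" using finite_E by (auto simp: leading_def)
  then have "card {e \<in> E. card (missing e) \<le> 1} \<le> card ?L + card ?L'"
    using few_missing_subset_leading[OF inj(1)] card_mono card_Un_le order_trans by meson
  then have "real (card E) \<le> 2 * (real (card ?L) + real (card ?L'))"
    using card_few_missing_ge[OF assms] by simp
  then show ?thesis
    using card_leading_le[OF inj(1)] card_leading_le[OF inj(2)] by simp
qed

end

theorem theorem3p4:
  fixes V :: "'a set" and E :: "'a set set" and n r t :: nat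
  assumes "card V = n"
    and "real r = real n / 4"
    and "ruzsa_szemeredi V E r t"
  shows "real t \<le> 8 * (log 2 (real n) + 1)"
proof -
  obtain P where P: "simple_graph V E" "partition_on E P" "card P = t"
      "\<And>M. M \<in> P \<Longrightarrow> induced_matching E M \<and> card M = r"
    using assms(3) by (auto simp: ruzsa_szemeredi_def)
  interpret induced_matching_partition V E P using P by unfold_locales auto
  have n: "n = 4 * r" using assms(2) by linarith
  have E: "card E = t * r" using sum_card_P P by simp
  show ?thesis
  \<comment> \<open>Without edges the partition has no blocks, and \<open>log 2 0 = 0\<close> makes
    the bound 8. Otherwise \<open>r\<close> can be cancelled, with
    \<open>2 * n = 8 * r\<close>.\<close>
  proof (cases "r = 0")
    case True
    then have "E = {}" using E finite_E by simp
    then have "P = {}" using P(2) by (simp add: partition_on_empty)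
    then have "t = 0" using P(3) by simp
    then show ?thesis using n True by (simp add: log_def)
  next
    case False
    have "real (t * r) \<le> 2 * real n * log 2 (2 * n)"
      using card_edges_le assms(1) n E P(3) by simp
    also have "\<dots> = 8 * (log 2 n + 1) * r"
    proof -
      have "log 2 (2 * n) = log 2 n + 1" using False n by (subst of_nat_mult, subst log_mult) auto
      then show ?thesis using n by simp
    qed
    finally show ?thesis using False by simp
  qed
qed

end
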